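(* Let $n\ge 1$ and let $A$ be a $2n\times 2n$ real symmetric positive definite matrix, written in block form $A=\begin{pmatrix} A_{11} & A_{12}\\ A_{12}^T & A_{22}\end{pmatrix}$ with $n\times n$ blocks. Let $\Delta_{11},\Delta_{22}\in\mathbb{R}^n$ be the vectors of diagonal entries of $A_{11}$ and $A_{22}$ (their entries are positive), and set $\Delta_{\mathrm{s}}(A)\coloneqq\sqrt{\Delta_{11}\cdot\Delta_{22}}$ (entrywise product and square root). Define the $2n\times 2n$ diagonal matrix $$M\coloneqq \operatorname{diag}\!\left(\sqrt[4]{\Delta_{11}^{-1}\cdot\Delta_{22}}\right)\oplus \operatorname{diag}\!\left(\sqrt[4]{\Delta_{11}\cdot\Delta_{22}^{-1}}\right),$$ where all operations on vectors are entrywise. Then $M$ is symplectic, and $\Delta_{\mathrm{s}}(A)\prec d_{\mathrm{s}}(A)$ holds if and only if $MAM$ is orthosymplectically diagonalizable in the sense of Williamson's theorem.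
   Context: Let $J_{2n}=\begin{pmatrix}0 & I_n\\ -I_n & 0\end{pmatrix}$. A $2n\times 2n$ real matrix $S$ is symplectic if $S^TJ_{2n}S=J_{2n}$; $S$ is orthosymplectic if it is symplectic and orthogonal ($S^TS=I_{2n}$). Williamson's theorem: for every $2n\times 2n$ real symmetric positive definite matrix $B$ there is a symplectic $S$ with $S^TBS=\begin{pmatrix} D&0\\0&D\end{pmatrix}$, where $D$ is an $n\times n$ diagonal matrix with positive diagonal entries; these diagonal entries, which are uniquely determined up to order, are the symplectic eigenvalues of $B$, and $d_{\mathrm{s}}(B)\in\mathbb{R}^n$ denotes the vector of symplectic eigenvalues $d_1(B)\le\cdots\le d_n(B)$. $B$ is called orthosymplectically diagonalizable in the sense of Williamson's theorem if such an $S$ can be chosen orthosymplectic. For $x\in\mathbb{R}^n$ write $x^\uparrow_1\le\cdots\le x^\uparrow_n$ for its entries in increasing order. For $x,y\in\mathbb{R}^n$, $x$ is majorized by $y$, written $x\prec y$, if $\sum_{i=1}^k x^\uparrow_i\ge\sum_{i=1}^k y^\uparrow_i$ for $k=1,\dots,n$, with equality for $k=n$. $\operatorname{diag}(x)$ is the diagonal matrix with diagonal $x$, and $\oplus$ denotes the usual block-diagonal direct sum. *)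

theory Defs
  imports "HOL-Analysis.Analysis" "HOL-Library.Multiset"
begin

text \<open>A 2n x 2n real matrix is indexed by the type 'n + 'n: index Inl i is the
  i-th row/column of the first block, Inr i the i-th of the second block.\<close>

type_synonym ('n) sqmat2 = "real ^ ('n + 'n) ^ ('n + 'n)"

definition Jmat :: "('n::finite) sqmat2" where
  "Jmat = (\<chi> r c. case (r, c) of
      (Inl a, Inr b) \<Rightarrow> (if a = b then 1 else 0)
    | (Inr a, Inl b) \<Rightarrow> (if a = b then -1 else 0)
    | _ \<Rightarrow> 0)"

definition symplectic :: "('n::finite) sqmat2 \<Rightarrow> bool" where
  "symplectic S \<longleftrightarrow> transpose S ** Jmat ** S = Jmat"

definition orthosymplectic :: "('n::finite) sqmat2 \<Rightarrow> bool" where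
  "orthosymplectic S \<longleftrightarrow> symplectic S \<and> orthogonal_matrix S"

definition sym_posdef :: "real ^ 'm ^ 'm \<Rightarrow> bool" where
  "sym_posdef B \<longleftrightarrow> transpose B = B \<and> (\<forall>x. x \<noteq> 0 \<longrightarrow> x \<bullet> (B *v x) > 0)"

definition blockdiag :: "real ^ 'n \<Rightarrow> real ^ 'n \<Rightarrow> ('n::finite) sqmat2" where
  "blockdiag d d' = (\<chi> r c. if r = c then (case r of Inl i \<Rightarrow> d $ i | Inr i \<Rightarrow> d' $ i) else 0)"

definition williamson_form :: "('n::finite) sqmat2 \<Rightarrow> ('n::finite) sqmat2 \<Rightarrow> real ^ 'n \<Rightarrow> bool" where
  "williamson_form B S d \<longleftrightarrow> (\<forall>i. d $ i > 0) \<and> transpose S ** B ** S = blockdiag d d"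

text \<open>Vector of symplectic eigenvalues (determined up to order by Williamson's theorem;
  all uses below are invariant under reordering since majorization sorts entries).\<close>
definition sympl_eigs :: "('n::finite) sqmat2 \<Rightarrow> real ^ 'n" where
  "sympl_eigs B = (SOME d. \<exists>S. symplectic S \<and> williamson_form B S d)"

definition orthosymp_diagonalizable :: "('n::finite) sqmat2 \<Rightarrow> bool" where
  "orthosymp_diagonalizable B \<longleftrightarrow> (\<exists>S d. orthosymplectic S \<and> williamson_form B S d)"

definition sorted_entries :: "real ^ ('n::finite) \<Rightarrow> real list" where
  "sorted_entries x = sorted_list_of_multiset (image_mset (\<lambda>i. x $ i) (mset_set UNIV))"

definition majorized :: "real ^ ('n::finite) \<Rightarrow> real ^ 'n \<Rightarrow> bool" where
  "majorized x y \<longleftrightarrow>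
     (\<forall>k \<in> {1..CARD('n)}. sum_list (take k (sorted_entries x)) \<ge> sum_list (take k (sorted_entries y)))
     \<and> sum_list (sorted_entries x) = sum_list (sorted_entries y)"

definition Delta11 :: "('n::finite) sqmat2 \<Rightarrow> real ^ 'n" where
  "Delta11 A = (\<chi> i. A $ Inl i $ Inl i)"

definition Delta22 :: "('n::finite) sqmat2 \<Rightarrow> real ^ 'n" where
  "Delta22 A = (\<chi> i. A $ Inr i $ Inr i)"

definition Delta_s :: "('n::finite) sqmat2 \<Rightarrow> real ^ 'n" where
  "Delta_s A = (\<chi> i. sqrt (Delta11 A $ i * Delta22 A $ i))"

definition Mmat :: "('n::finite) sqmat2 \<Rightarrow> ('n::finite) sqmat2" where
  "Mmat A = blockdiag (\<chi> i. root 4 (inverse (Delta11 A $ i) * Delta22 A $ i))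
                      (\<chi> i. root 4 (Delta11 A $ i * inverse (Delta22 A $ i)))"

end

theory Submission
  imports Defs
begin

text \<open>Congruence by \<open>Mmat A\<close> keeps the symplectic eigenvalues and makes both halves of the diagonal
  equal to \<open>Delta_s A\<close>. If this vector is majorized by the symplectic eigenvalues \<open>d\<close>, then
  \<open>B = Mmat A ** A ** Mmat A\<close> has trace \<open>2 * (\<Sum>i. d $ i)\<close>, the smallest value possible for a
  matrix with these symplectic eigenvalues, and Cauchy--Schwarz with equality on the rows of a
  diagonalizing matrix forces that matrix to be orthogonal. Only the total sum in the majorization
  is used here. Conversely, an orthosymplectic \<open>S\<close> with blocks \<open>X, Y, -Y, X\<close> expresses the diagonal of
  \<open>B\<close> through \<open>d\<close> by the doubly stochastic matrix with entries \<open>X\<^sub>i\<^sub>j\<^sup>2 + Y\<^sub>i\<^sub>j\<^sup>2\<close>.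

  Williamson's theorem is obtained by minimizing a trace with distinct weights over the
  symplectic matrices. Uniqueness of \<open>d\<close>: a symplectic matrix \<open>R\<close> relating two diagonal forms
  can only have a nonzero entry where the diagonal entries agree, and since \<open>det R \<noteq> 0\<close> some
  permutation avoids all zero entries.\<close>

section \<open>Block matrices over a sum type and the symplectic group\<close>

lemma sum_UNIV_Plus:
  "(\<Sum>r\<in>UNIV. f r) = (\<Sum>i\<in>UNIV. f (Inl i)) + (\<Sum>i\<in>UNIV. f (Inr i))"
  for f :: "'a::finite + 'b::finite \<Rightarrow> 'c::comm_monoid_add"
  by (subst UNIV_Plus_UNIV[symmetric], subst sum.Plus) simp_all

lemma Jmat_nth [simp]:
  "Jmat $ Inl a $ Inl b = 0" "Jmat $ Inr a $ Inr b = 0"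
  "Jmat $ Inl a $ Inr b = (if a = b then 1 else 0)"
  "Jmat $ Inr a $ Inl b = (if a = b then -1 else 0)"
  by (simp_all add: Jmat_def)

lemma if_mult_zero:
  "(if P then a else 0) * b = (if P then a * b else (0::real))"
  "b * (if P then a else 0) = (if P then b * a else (0::real))"
  by simp_all

lemma Jmat_mult_nth [simp]:
  "(Jmat ** S) $ Inl a $ c = S $ Inr a $ c"
  "(Jmat ** S) $ Inr a $ c = - S $ Inl a $ c"
  "(S ** Jmat) $ r $ Inl b = - S $ r $ Inr b"
  "(S ** Jmat) $ r $ Inr b = S $ r $ Inl b"
  by (simp_all add: matrix_matrix_mult_def sum_UNIV_Plus if_mult_zero)

lemma Jmat_mult_vec_nth [simp]:
  "(Jmat *v x) $ Inl a = x $ Inr a"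
  "(Jmat *v x) $ Inr a = - x $ Inl a"
  by (simp_all add: matrix_vector_mult_def sum_UNIV_Plus if_mult_zero)

lemma blockdiag_nth:
  "blockdiag d d' $ r $ c = (if r = c then (case r of Inl i \<Rightarrow> d $ i | Inr i \<Rightarrow> d' $ i) else 0)"
  by (simp add: blockdiag_def)

lemma blockdiag_nth_simps [simp]:
  "blockdiag d d' $ Inl i $ Inl j = (if i = j then d $ i else 0)"
  "blockdiag d d' $ Inr i $ Inr j = (if i = j then d' $ i else 0)"
  "blockdiag d d' $ Inl i $ Inr j = 0"
  "blockdiag d d' $ Inr i $ Inl j = 0"
  by (simp_all add: blockdiag_nth)

lemma blockdiag_mult_nth:
  "(blockdiag d d' ** S) $ r $ c = (case r of Inl i \<Rightarrow> d $ i | Inr i \<Rightarrow> d' $ i) * S $ r $ c"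
  "(S ** blockdiag d d') $ r $ c = S $ r $ c * (case c of Inl i \<Rightarrow> d $ i | Inr i \<Rightarrow> d' $ i)"
  by (cases r; cases c; simp add: matrix_matrix_mult_def sum_UNIV_Plus if_mult_zero)+

lemma transpose_blockdiag [simp]: "transpose (blockdiag d d') = blockdiag d d'"
  by (simp add: vec_eq_iff transpose_def blockdiag_nth)

lemma matrix_eq_sum_index:
  fixes P Q :: "('n::finite) sqmat2"
  shows "P = Q \<longleftrightarrow>
    (\<forall>i j. P $ Inl i $ Inl j = Q $ Inl i $ Inl j \<and> P $ Inl i $ Inr j = Q $ Inl i $ Inr j \<and>
           P $ Inr i $ Inl j = Q $ Inr i $ Inl j \<and> P $ Inr i $ Inr j = Q $ Inr i $ Inr j)"
  by (auto simp: vec_eq_iff split_sum_all)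

lemma Jmat_square: "Jmat ** Jmat = - mat 1"
  by (simp add: matrix_eq_sum_index mat_def)

lemma symplectic_blockdiag:
  assumes "\<And>i. a $ i * b $ i = 1"
  shows "symplectic (blockdiag a b)"
  using assms unfolding symplectic_def transpose_blockdiag
  by (simp add: matrix_eq_sum_index blockdiag_mult_nth mult.commute)

lemma symplectic_mat_1: "symplectic (mat 1)"
  by (simp add: symplectic_def)

lemma congruence_mult:
  fixes B S T :: "real ^ 'm ^ 'm"
  shows "transpose (S ** T) ** B ** (S ** T) = transpose T ** (transpose S ** B ** S) ** T"
  by (simp add: matrix_transpose_mul matrix_mul_assoc)

lemma symplectic_mult:
  assumes "symplectic S" "symplectic T"
  shows "symplectic (S ** T)"
  using assms unfolding symplectic_def congruence_mult by simp

lemma matrix_mul_minus: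
  "(- A) ** B = - (A ** B)" "A ** (- B) = - (A ** B)"
  for A B :: "real ^ 'n ^ 'n"
  by (simp_all add: matrix_matrix_mult_def vec_eq_iff sum_negf)

text \<open>Since \<open>Jmat\<close> squares to \<open>- mat 1\<close>, the inverse is explicitly
  \<open>- (Jmat ** transpose S ** Jmat)\<close>. The last fact says that \<open>transpose S\<close>
  is symplectic too, which gives relations between rows.\<close>

lemma symplectic_inverse:
  fixes S :: "('n::finite) sqmat2"
  assumes S: "symplectic S"
  obtains T where "symplectic T" "T ** S = mat 1" "S ** T = mat 1"
    "S ** Jmat ** transpose S = Jmat"
proof -
  define T where "T = - (Jmat ** transpose S ** Jmat)"
  have "T ** S = - (Jmat ** (transpose S ** Jmat ** S))"
    by (simp add: T_def matrix_mul_minus matrix_mul_assoc)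
  also have "\<dots> = mat 1" using S by (simp add: symplectic_def Jmat_square)
  finally have TS: "T ** S = mat 1" .
  then have ST: "S ** T = mat 1" by (simp add: matrix_left_right_inverse)
  have "transpose T ** Jmat ** T = transpose T ** (transpose S ** Jmat ** S) ** T"
    using S by (simp add: symplectic_def)
  also have "\<dots> = transpose (S ** T) ** Jmat ** (S ** T)" by (rule congruence_mult[symmetric])
  finally have sT: "symplectic T" by (simp add: ST symplectic_def)
  \<comment> \<open>Appending \<open>Jmat ** Jmat\<close> makes the explicit inverse
    \<open>T\<close> appear to the right of \<open>S\<close>.\<close>
  have "S ** Jmat ** transpose S = - (S ** Jmat ** transpose S ** (Jmat ** Jmat))"
    by (simp add: Jmat_square matrix_mul_minus)
  also have "\<dots> = (S ** T) ** Jmat"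
    by (simp add: T_def matrix_mul_minus matrix_mul_assoc)
  finally have "S ** Jmat ** transpose S = Jmat" by (simp add: ST)
  with sT TS ST show ?thesis by (rule that)
qed

lemma congruence_nth:
  fixes S B :: "real ^ 'm ^ 'm"
  shows "(transpose S ** B ** S) $ k $ l = column k S \<bullet> (B *v column l S)"
proof -
  have "(transpose S ** B ** S) $ k $ l = (transpose S ** (B ** S)) $ k $ l"
    by (simp add: matrix_mul_assoc)
  then show ?thesis
    by (simp add: matrix_matrix_mult_def matrix_vector_mult_def transpose_def column_def inner_vec_def)
qed

lemma congruence_blockdiag_diag:
  fixes T :: "('n::finite) sqmat2"
  shows "(transpose T ** blockdiag d d ** T) $ p $ p
    = (\<Sum>j\<in>UNIV. d $ j * ((T $ Inl j $ p)\<^sup>2 + (T $ Inr j $ p)\<^sup>2))"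
proof -
  have "(transpose T ** blockdiag d d ** T) $ p $ p =
     (\<Sum>r\<in>UNIV. T $ r $ p * (case r of Inl i \<Rightarrow> d $ i | Inr i \<Rightarrow> d $ i) * T $ r $ p)"
    by (subst matrix_matrix_mult_def) (simp add: blockdiag_mult_nth transpose_def)
  also have "\<dots> = (\<Sum>j\<in>UNIV. d $ j * ((T $ Inl j $ p)\<^sup>2 + (T $ Inr j $ p)\<^sup>2))"
    by (simp add: sum_UNIV_Plus sum.distrib[symmetric] algebra_simps power2_eq_square)
  finally show ?thesis .
qed

section \<open>Majorization\<close>

text \<open>Sorting indices instead of values turns partial sums of sorted entries into sums over
  index sets.\<close>

lemma sorted_entries_enum:
  fixes x :: "real ^ ('n::finite)"
  obtains xs where "distinct xs" "set xs = UNIV" "length xs = CARD('n)"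
    "sorted (map (($) x) xs)" "sorted_entries x = map (($) x) xs"
proof -
  obtain ys :: "'n list" where ys: "set ys = UNIV" "distinct ys"
    using finite_distinct_list[OF finite] by blast
  define xs where "xs = sort_key (($) x) ys"
  have m: "mset_set UNIV = mset ys" using ys by (metis mset_set_set)
  have "sorted_entries x = sort (map (($) x) ys)"
    unfolding sorted_entries_def m by (metis mset_map sorted_list_of_multiset_mset)
  also have "\<dots> = map (($) x) xs"
    unfolding xs_def by (rule properties_for_sort) simp_all
  finally have eq: "sorted_entries x = map (($) x) xs" .
  have d: "distinct xs" "set xs = UNIV" using ys by (simp_all add: xs_def)
  moreover have "length xs = CARD('n)" using d by (metis distinct_card)
  moreover have "sorted (map (($) x) xs)" by (simp add: xs_def)
  ultimately show ?thesis using eq that by blast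
qed

lemma sum_list_sorted_entries: "sum_list (sorted_entries x) = (\<Sum>i\<in>UNIV. x $ i)"
proof -
  obtain xs where "distinct xs" "set xs = UNIV" "sorted_entries x = map (($) x) xs"
    by (rule sorted_entries_enum)
  then show ?thesis by (metis sum_list_distinct_conv_sum_set)
qed

text \<open>\<open>I\<close> holds the indices of \<open>k\<close> smallest entries, with ties
  broken by the enumeration; \<open>t\<close> is the \<open>k\<close>-th smallest entry and serves
  as a threshold.\<close>

lemma sum_take_sorted_entries:
  fixes x :: "real ^ ('n::finite)"
  assumes k: "k \<in> {1..CARD('n)}"
  obtains I t where "card I = k" "sum_list (take k (sorted_entries x)) = (\<Sum>i\<in>I. x $ i)"
    "\<And>i. i \<in> I \<Longrightarrow> x $ i \<le> t" "\<And>i. i \<notin> I \<Longrightarrow> t \<le> x $ i"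
proof -
  obtain xs where xs: "distinct xs" "set xs = UNIV" "length xs = CARD('n)"
    "sorted (map (($) x) xs)" "sorted_entries x = map (($) x) xs"
    by (rule sorted_entries_enum)
  define I where "I = set (take k xs)"
  define t where "t = x $ (xs ! (k - 1))"
  have mono: "x $ (xs ! a) \<le> x $ (xs ! b)" if "a \<le> b" "b < length xs" for a b
    using sorted_nth_mono[OF xs(4), of a b] that by simp
  have "card I = k" unfolding I_def using xs k by (simp add: distinct_card)
  moreover have "sum_list (take k (sorted_entries x)) = (\<Sum>i\<in>I. x $ i)"
    unfolding I_def xs(5) take_map using xs(1) by (simp add: sum_list_distinct_conv_sum_set)
  moreover have "x $ i \<le> t" if "i \<in> I" for i
  proof -
    from that obtain a where "a < k" "i = xs ! a"
      unfolding I_def by (auto simp: in_set_conv_nth)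
    then show ?thesis unfolding t_def using mono[of a "k - 1"] k xs(3) by auto
  qed
  moreover have "t \<le> x $ i" if "i \<notin> I" for i
  proof -
    obtain a where a: "a < length xs" "i = xs ! a" using xs(2) by (metis UNIV_I in_set_conv_nth)
    have "\<not> a < k"
    proof
      assume "a < k"
      then have "take k xs ! a = i" "a < length (take k xs)" using a by auto
      then show False using that unfolding I_def by (metis nth_mem)
    qed
    then show ?thesis unfolding t_def using mono[of "k - 1" a] a by auto
  qed
  ultimately show ?thesis by (rule that)
qed

text \<open>The averaging direction of the Hardy-Littlewood-Polya theorem: a sum of \<open>k\<close>
  entries of \<open>x\<close> is a combination of entries of \<open>y\<close> with weights in [0,1]
  of total \<open>k\<close>, which is least when the weight sits on \<open>k\<close> smallest
  entries.\<close>

lemma majorized_doubly_stochastic: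
  fixes x y :: "real ^ ('n::finite)" and P :: "'n \<Rightarrow> 'n \<Rightarrow> real"
  assumes x: "\<And>i. x $ i = (\<Sum>j\<in>UNIV. P i j * y $ j)"
    and nonneg: "\<And>i j. P i j \<ge> 0"
    and row: "\<And>i. (\<Sum>j\<in>UNIV. P i j) = 1" and col: "\<And>j. (\<Sum>i\<in>UNIV. P i j) = 1"
  shows "majorized x y"
proof -
  have tot: "(\<Sum>i\<in>UNIV. x $ i) = (\<Sum>j\<in>UNIV. y $ j)"
  proof -
    have "(\<Sum>i\<in>UNIV. x $ i) = (\<Sum>j\<in>UNIV. \<Sum>i\<in>UNIV. P i j * y $ j)"
      unfolding x by (rule sum.swap)
    then show ?thesis by (simp add: sum_distrib_right[symmetric] col)
  qed
  have "sum_list (take k (sorted_entries y)) \<le> sum_list (take k (sorted_entries x))"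
    if k: "k \<in> {1..CARD('n)}" for k
  proof -
    obtain I s where I: "card I = k" "sum_list (take k (sorted_entries x)) = (\<Sum>i\<in>I. x $ i)"
      using sum_take_sorted_entries[OF k, of x] by metis
    obtain K t where K: "card K = k" "sum_list (take k (sorted_entries y)) = (\<Sum>i\<in>K. y $ i)"
      "\<And>i. i \<in> K \<Longrightarrow> y $ i \<le> t" "\<And>i. i \<notin> K \<Longrightarrow> t \<le> y $ i"
      using sum_take_sorted_entries[OF k, of y] by blast
    define c where "c j = (\<Sum>i\<in>I. P i j)" for j
    have c0: "c j \<ge> 0" for j unfolding c_def by (simp add: nonneg sum_nonneg)
    have c1: "c j \<le> 1" for j
      unfolding c_def col[of j, symmetric] by (rule sum_mono2) (simp_all add: nonneg)
    have csum: "(\<Sum>j\<in>UNIV. c j) = real k"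
      unfolding c_def by (subst sum.swap) (simp add: row I)
    have "(\<Sum>i\<in>I. x $ i) = (\<Sum>j\<in>UNIV. c j * y $ j)"
      unfolding x c_def sum_distrib_right by (rule sum.swap)
    \<comment> \<open>After the shift by \<open>t\<close> the terms are nonpositive on
      \<open>K\<close> and nonnegative off it, so replacing \<open>c\<close> by the indicator of
      \<open>K\<close> can only lower the sum.\<close>
    also have "\<dots> = (\<Sum>j\<in>UNIV. c j * (y $ j - t)) + real k * t"
      by (simp add: algebra_simps sum_subtractf sum_distrib_left[symmetric] csum)
    also have "\<dots> \<ge> (\<Sum>j\<in>UNIV. if j \<in> K then y $ j - t else 0) + real k * t"
    proof (intro add_right_mono sum_mono)
      fix j
      show "(if j \<in> K then y $ j - t else 0) \<le> c j * (y $ j - t)"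
      proof (cases "j \<in> K")
        case True
        then have "(1 - c j) * (t - y $ j) \<ge> 0" using K(3) c1 by simp
        then show ?thesis using True by (simp add: algebra_simps)
      next
        case False
        then show ?thesis using K(4) c0 by simp
      qed
    qed
    also have "(\<Sum>j\<in>UNIV. if j \<in> K then y $ j - t else 0) + real k * t = (\<Sum>j\<in>K. y $ j)"
      by (simp add: sum.If_cases sum_subtractf K(1))
    finally show ?thesis using I K by simp
  qed
  then show ?thesis by (simp add: majorized_def sum_list_sorted_entries tot)
qed

section \<open>Symplectic eigenvalues\<close>

lemma image_mset_UNIV_Plus:
  "image_mset f (mset_set UNIV) =
   image_mset (\<lambda>i. f (Inl i)) (mset_set UNIV) + image_mset (\<lambda>i. f (Inr i)) (mset_set UNIV)"
  for f :: "'a::finite + 'b::finite \<Rightarrow> 'c"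
proof -
  have "mset_set (UNIV :: ('a + 'b) set) = mset_set (range Inl \<union> range Inr)"
    by (simp add: UNIV_sum)
  also have "\<dots> = mset_set (range Inl) + mset_set (range Inr)"
    by (rule mset_set_Union) auto
  also have "\<dots> = image_mset Inl (mset_set UNIV) + image_mset Inr (mset_set UNIV)"
    by (simp add: image_mset_mset_set)
  finally show ?thesis by (simp add: image_mset.compositionality comp_def)
qed

lemma symplectic_eigenvalues_unique:
  fixes B S S' :: "('n::finite) sqmat2"
  assumes S: "symplectic S" and S': "symplectic S'"
    and w: "williamson_form B S d" and w': "williamson_form B S' d'"
  shows "sorted_entries d = sorted_entries d'"
proof -
  obtain T where T: "symplectic T" "T ** S = mat 1" "S ** T = mat 1"
    using symplectic_inverse[OF S] by blast
  define R where "R = T ** S'"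
  have R: "symplectic R" unfolding R_def using T S' by (simp add: symplectic_mult)
  obtain R' where R': "R' ** R = mat 1" "R ** Jmat ** transpose R = Jmat"
    using symplectic_inverse[OF R] by blast
  have SR: "S ** R = S'" by (simp add: R_def matrix_mul_assoc T)
  have "transpose R ** blockdiag d d ** R = transpose (S ** R) ** B ** (S ** R)"
    using w unfolding williamson_form_def congruence_mult by simp
  also have "\<dots> = blockdiag d' d'" using w' by (simp add: SR williamson_form_def)
  finally have E: "transpose R ** blockdiag d d ** R = blockdiag d' d'" .
  \<comment> \<open>Multiplying \<open>E\<close> by \<open>R ** Jmat\<close> removes
    \<open>transpose R\<close> and leaves a relation linear in \<open>R\<close>.\<close>
  have "R ** Jmat ** blockdiag d' d' = (R ** Jmat ** transpose R) ** blockdiag d d ** R"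
    by (simp add: E[symmetric] matrix_mul_assoc)
  then have I: "R ** Jmat ** blockdiag d' d' = Jmat ** (blockdiag d d ** R)"
    by (simp add: R' matrix_mul_assoc)
  have pos: "d $ i > 0" "d' $ i > 0" for i using w w' by (simp_all add: williamson_form_def)
  \<comment> \<open>Entries of \<open>R\<close> are coupled in pairs by two equations; eliminating
    \<open>b\<close> gives \<open>a * v * v = a * u * u\<close>.\<close>
  have cross: "u = v"
    if "u > 0" "v > 0" "a * v = u * b" "b * v = u * a" "a \<noteq> 0" for a b u v :: real
  proof -
    have "a * v * v = u * (b * v)" using that by simp
    also have "\<dots> = a * u * u" using that by simp
    finally have "v * v = u * u" using that(5) by (simp add: mult.assoc)
    then show ?thesis using that(1,2) by (auto simp: square_eq_iff)
  qed
  \<comment> \<open>The diagonals of the two forms as functions on the full index type, so each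
    eigenvalue occurs twice.\<close>
  define e e' where "e = case_sum (($) d) (($) d)" and "e' = case_sum (($) d') (($) d')"
  have 1: "- R $ Inl i $ Inr j * d' $ j = d $ i * R $ Inr i $ Inl j"
      "R $ Inr i $ Inl j * d' $ j = d $ i * - R $ Inl i $ Inr j"
      "R $ Inl i $ Inl j * d' $ j = d $ i * R $ Inr i $ Inr j"
      "R $ Inr i $ Inr j * d' $ j = d $ i * R $ Inl i $ Inl j" for i j
    using arg_cong[OF I, of "\<lambda>P. P $ Inl i $ Inl j"] arg_cong[OF I, of "\<lambda>P. P $ Inl i $ Inr j"]
      arg_cong[OF I, of "\<lambda>P. P $ Inr i $ Inl j"] arg_cong[OF I, of "\<lambda>P. P $ Inr i $ Inr j"]
    by (simp_all add: blockdiag_mult_nth)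
  have supp: "e p = e' q" if "R $ p $ q \<noteq> 0" for p q
    using that by (cases p; cases q)
      (auto simp: e_def e'_def intro: cross[OF pos 1(1,2)] cross[OF pos 1(2,1)]
        cross[OF pos 1(3,4)] cross[OF pos 1(4,3)])
  have "det R \<noteq> 0" using R'(1) by (metis det_I det_mul mult_zero_right zero_neq_one)
  \<comment> \<open>A nonzero determinant has a nonzero term in its Leibniz expansion.\<close>
  then obtain \<pi> where \<pi>: "\<pi> permutes (UNIV :: ('n + 'n) set)" "(\<Prod>p\<in>UNIV. R $ p $ \<pi> p) \<noteq> 0"
    unfolding det_def by (metis (mono_tags, lifting) mem_Collect_eq mult_zero_right sum.neutral)
  have ee: "e = e' \<circ> \<pi>" using \<pi>(2) supp by (auto simp: fun_eq_iff)
  have "image_mset e (mset_set UNIV) = image_mset e' (image_mset \<pi> (mset_set UNIV))"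
    by (simp add: ee image_mset.compositionality)
  also have "image_mset \<pi> (mset_set UNIV) = mset_set UNIV"
    using \<pi>(1) by (simp add: image_mset_mset_set permutes_inj permutes_surj)
  finally have "image_mset (($) d) (mset_set UNIV) + image_mset (($) d) (mset_set UNIV)
     = image_mset (($) d') (mset_set UNIV) + image_mset (($) d') (mset_set UNIV)"
    by (simp add: image_mset_UNIV_Plus e_def e'_def)
  \<comment> \<open>All multiplicities are doubled on both sides, so they can be halved.\<close>
  then have "image_mset (($) d) (mset_set UNIV) = image_mset (($) d') (mset_set UNIV)"
    by (auto simp: multiset_eq_iff simp del: count_image_mset) (metis add_self_div_2)
  then show ?thesis by (simp add: sorted_entries_def)
qed

section \<open>Williamson's theorem\<close>

text \<open>The constant is the minimum of the quadratic form on the compact unit sphere;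
  homogeneity extends the bound.\<close>

lemma sym_posdef_coercive:
  fixes B :: "real ^ 'm ^ 'm"
  assumes "sym_posdef B"
  obtains c where "c > 0" "\<And>x. x \<bullet> (B *v x) \<ge> c * (norm x)\<^sup>2"
proof -
  have cont: "continuous_on (sphere 0 1) (\<lambda>x. x \<bullet> (B *v x))"
    by (intro continuous_intros matrix_vector_mult_linear_continuous_on)
  have "sphere 0 1 \<noteq> ({} :: (real ^ 'm) set)" by simp
  then obtain z where z: "z \<in> sphere 0 1" "\<And>x. x \<in> sphere 0 1 \<Longrightarrow> z \<bullet> (B *v z) \<le> x \<bullet> (B *v x)"
    using continuous_attains_inf[OF compact_sphere _ cont] by blast
  show ?thesis
  proof
    have "z \<noteq> 0" using z(1) by auto
    then show "z \<bullet> (B *v z) > 0" using assms by (simp add: sym_posdef_def)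
  next
    fix x :: "real ^ 'm"
    show "x \<bullet> (B *v x) \<ge> z \<bullet> (B *v z) * (norm x)\<^sup>2"
    proof (cases "x = 0")
      case False
      define u where "u = (1 / norm x) *\<^sub>R x"
      have "u \<in> sphere 0 1" using False by (simp add: u_def)
      moreover have x: "x = norm x *\<^sub>R u" using False by (simp add: u_def)
      moreover have "x \<bullet> (B *v x) = (norm x)\<^sup>2 * (u \<bullet> (B *v u))"
        by (subst (1 2) x) (simp only: matrix_vector_mult_scaleR inner_scaleR_left inner_scaleR_right
              power2_eq_square mult.assoc)
      ultimately show ?thesis using z(2)[of u]
        by (simp add: mult.commute[of _ "(norm x)\<^sup>2"] mult_left_mono)
    qed simp
  qed
qed

text \<open>First-order optimality without derivatives: for \<open>b \<noteq> 0\<close> a suitable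
  small step makes the quadratic negative.\<close>

lemma linear_coeff_zero:
  fixes b c :: real
  assumes "\<And>t. 0 \<le> 2 * t * b + t\<^sup>2 * c"
  shows "b = 0"
proof (rule ccontr)
  assume "b \<noteq> 0"
  \<comment> \<open>A positive upper bound of \<open>c\<close>, also when \<open>c\<close> is zero
    or negative.\<close>
  define m where "m = \<bar>c\<bar> + 1"
  have "m > 0" "c \<le> m" by (simp_all add: m_def)
  have "0 \<le> 2 * (- b / m) * b + (- b / m)\<^sup>2 * c" by (rule assms)
  also have "\<dots> \<le> 2 * (- b / m) * b + (- b / m)\<^sup>2 * m"
    using \<open>c \<le> m\<close> by (intro add_left_mono mult_left_mono) auto
  also have "\<dots> = - b\<^sup>2 / m" using \<open>m > 0\<close> by (simp add: field_simps power2_eq_square)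
  also have "\<dots> < 0" using \<open>m > 0\<close> \<open>b \<noteq> 0\<close> by simp
  finally show False by simp
qed

text \<open>Polarization on basis vectors.\<close>

lemma quadratic_form_zero_imp_skew:
  fixes G :: "real ^ 'm ^ 'm"
  assumes "\<And>v. v \<bullet> (G *v v) = 0"
  shows "G $ p $ q = - G $ q $ p"
proof -
  have ax: "axis a 1 \<bullet> (G *v axis b 1) = G $ a $ b" for a b
    by (simp add: inner_axis' matrix_vector_mult_basis column_def)
  show ?thesis
    using assms[of "axis p 1 + axis q 1"] assms[of "axis p 1"] assms[of "axis q 1"]
    by (simp add: matrix_vector_right_distrib inner_add_left inner_add_right ax)
qed

lemma Jmat_skew: "v \<bullet> (Jmat *v v) = 0"
  by (simp add: inner_vec_def sum_UNIV_Plus sum_negf mult.commute)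

text \<open>The symplectic transvection sending x to x + t (v . x) J v. It is affine in
  \<open>t\<close>, so a quadratic objective along it is exactly quadratic in
  \<open>t\<close>.\<close>

definition transvection :: "real \<Rightarrow> real ^ ('n::finite + 'n) \<Rightarrow> 'n sqmat2" where
  "transvection t v = (\<chi> r c. mat 1 $ r $ c + t * (Jmat *v v) $ r * v $ c)"

lemma column_transvection: "column k (transvection t v) = axis k 1 + (t * v $ k) *\<^sub>R (Jmat *v v)"
  by (auto simp: vec_eq_iff column_def transvection_def mat_def axis_def)

text \<open>In the pairing of two columns the terms linear in \<open>t\<close> cancel, and the
  quadratic one vanishes because \<open>Jmat\<close> is skew.\<close>

lemma symplectic_transvection:
  fixes v :: "real ^ ('n::finite + 'n)"
  shows "symplectic (transvection t v)"
proof -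
  have "column k (transvection t v) \<bullet> (Jmat *v column l (transvection t v)) = Jmat $ k $ l" for k l
  proof -
    have JJ: "Jmat *v (Jmat *v v) = - v" for v :: "real ^ ('n + 'n)"
      by (simp add: vec_eq_iff split_sum_all)
    have a: "axis k 1 \<bullet> x = x $ k" for x :: "real ^ ('n + 'n)" by (simp add: inner_axis')
    have J1: "Jmat *v axis l 1 = column l Jmat" by (simp add: matrix_vector_mult_basis)
    have J3: "column l Jmat $ k = Jmat $ k $ l" by (simp add: column_def)
    have J2: "(Jmat *v v) \<bullet> column l Jmat = v $ l"
      by (cases l) (simp_all add: inner_vec_def column_def sum_UNIV_Plus if_mult_zero)
    show ?thesis
      unfolding column_transvection matrix_vector_right_distrib matrix_vector_mult_scaleR JJ J1
        inner_add_left inner_add_right inner_scaleR_left inner_scaleR_right a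
      by (simp add: J2 J3 inner_commute[of "Jmat *v v" v] Jmat_skew)
  qed
  then show ?thesis unfolding symplectic_def by (simp add: vec_eq_iff congruence_nth)
qed

text \<open>The symplectic group is not compact, but a sublevel set of \<open>f\<close> on it is:
  coercivity and weights at least 1 bound every column of \<open>S\<close> by means of
  \<open>f S\<close>.\<close>

lemma minimizer_exists:
  fixes B :: "('n::finite) sqmat2" and w :: "'n + 'n \<Rightarrow> real"
  assumes B: "sym_posdef B" and w: "\<And>k. w k \<ge> 1"
  defines "f \<equiv> \<lambda>S. \<Sum>k\<in>UNIV. w k * (transpose S ** B ** S) $ k $ k"
  obtains S where "symplectic S" "\<And>T. symplectic T \<Longrightarrow> f S \<le> f T"
proof -
  obtain c where c: "c > 0" "\<And>x. x \<bullet> (B *v x) \<ge> c * (norm x)\<^sup>2"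
    using sym_posdef_coercive[OF B] by blast
  have cont: "continuous_on UNIV f"
    unfolding f_def transpose_def matrix_matrix_mult_def by (simp, intro continuous_intros)
  have contJ: "continuous_on UNIV (\<lambda>S::'n sqmat2. transpose S ** Jmat ** S)"
    unfolding transpose_def matrix_matrix_mult_def by (simp, intro continuous_intros)
  define K where "K = {S. symplectic S \<and> f S \<le> f (mat 1)}"
  have "K = {S. transpose S ** Jmat ** S = Jmat} \<inter> {S. f S \<le> f (mat 1)}"
    by (auto simp: K_def symplectic_def)
  then have cl: "closed K"
    by (simp only:) (intro closed_Int closed_Collect_eq closed_Collect_le cont contJ continuous_on_const)
  have bd: "\<bar>S $ r $ k\<bar> \<le> f (mat 1) / c + 1" if "S \<in> K" for S r k
  proof -
    have q: "(transpose S ** B ** S) $ l $ l \<ge> c * (norm (column l S))\<^sup>2" for l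
      using c(2) by (simp add: congruence_nth)
    have q0: "(transpose S ** B ** S) $ l $ l \<ge> 0" for l
      using q[of l] c(1) by (meson mult_nonneg_nonneg less_imp_le order_trans zero_le_power2)
    have "\<bar>S $ r $ k\<bar> \<le> norm (column k S)"
      using component_le_norm_cart[of "column k S" r] by (simp add: column_def)
    then have "(S $ r $ k)\<^sup>2 \<le> (norm (column k S))\<^sup>2" using abs_le_square_iff[of "S $ r $ k" "norm (column k S)"] by simp
    then have "c * (S $ r $ k)\<^sup>2 \<le> (transpose S ** B ** S) $ k $ k"
      using q[of k] c(1) by (meson mult_left_mono less_imp_le order_trans)
    also have "\<dots> \<le> w k * (transpose S ** B ** S) $ k $ k"
      using mult_right_mono[OF w[of k] q0[of k]] by simp
    also have "\<dots> \<le> f S" unfolding f_def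
      by (rule member_le_sum) (simp_all add: mult_nonneg_nonneg q0 order_trans[OF zero_le_one w])
    also have "\<dots> \<le> f (mat 1)" using that by (simp add: K_def)
    finally have sq: "\<bar>S $ r $ k\<bar>\<^sup>2 \<le> f (mat 1) / c" using c(1) by (simp add: field_simps)
    \<comment> \<open>Turns the bound on the square into a bound on the entry without a square
      root.\<close>
    have "\<bar>S $ r $ k\<bar> \<le> \<bar>S $ r $ k\<bar>\<^sup>2 + 1"
      using zero_le_power2[of "\<bar>S $ r $ k\<bar> - 1"] by (simp add: power2_diff)
    with sq show ?thesis by simp
  qed
  have "bounded K"
    unfolding bounded_iff
  proof (intro exI ballI)
    fix S assume "S \<in> K"
    have "norm S \<le> (\<Sum>r\<in>UNIV. norm (S $ r))" unfolding norm_vec_def by (rule L2_set_le_sum) simp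
    also have "\<dots> \<le> (\<Sum>r\<in>(UNIV::('n+'n) set). \<Sum>k\<in>(UNIV::('n+'n) set). \<bar>S $ r $ k\<bar>)"
      by (intro sum_mono norm_le_l1_cart)
    also have "\<dots> \<le> (\<Sum>r\<in>(UNIV::('n+'n) set). \<Sum>k\<in>(UNIV::('n+'n) set). f (mat 1) / c + 1)"
      by (intro sum_mono bd[OF \<open>S \<in> K\<close>])
    finally show "norm S \<le> \<dots>" .
  qed
  then have "compact K" using cl by (simp add: compact_eq_bounded_closed)
  moreover have "mat 1 \<in> K" by (simp add: K_def symplectic_mat_1)
  ultimately obtain S where S: "S \<in> K" "\<And>T. T \<in> K \<Longrightarrow> f S \<le> f T"
    using continuous_attains_inf[of K f] continuous_on_subset[OF cont] by blast
  show ?thesis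
  proof
    show "symplectic S" using S(1) by (simp add: K_def)
    fix T :: "'n sqmat2" assume "symplectic T"
    then show "f S \<le> f T" using S(2)[of T] S(1) by (cases "T \<in> K") (auto simp: K_def)
  qed
qed

lemma inner_symmetric_matrix:
  fixes C :: "real ^ 'm ^ 'm"
  assumes "transpose C = C"
  shows "x \<bullet> (C *v y) = y \<bullet> (C *v x)"
  by (metis assms dot_lmul_matrix inner_commute transpose_matrix_vector)

text \<open>Stationarity of a weighted trace under the transvections says that \<open>W ** C ** Jmat\<close> is skew;
  as the weights are distinct, this leaves only matrices of Williamson's form.\<close>

theorem williamson:
  fixes B :: "('n::finite) sqmat2"
  assumes B: "sym_posdef B"
  obtains S d where "symplectic S" "williamson_form B S d"
proof -
  obtain g :: "'n \<Rightarrow> nat" where g: "inj g"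
    using finite_imp_inj_to_nat_seg[of "UNIV :: 'n set"] by auto
  \<comment> \<open>Distinct weights across pairs will kill off-diagonal entries, while equal
    weights within a pair make its two diagonal entries agree. The shift by 1 keeps weights at least
    1.\<close>
  define h where "h i = real (g i) + 1" for i
  define w where "w = case_sum h h"
  define f where "f S = (\<Sum>k\<in>UNIV. w k * (transpose S ** B ** S) $ k $ k)" for S :: "'n sqmat2"
  have h1: "h i \<ge> 1" for i by (simp add: h_def)
  have w1: "w k \<ge> 1" for k by (cases k) (simp_all add: w_def h1)
  obtain S where S: "symplectic S" "\<And>T. symplectic T \<Longrightarrow> f S \<le> f T"
    by (rule minimizer_exists[of B w, OF B w1, folded f_def]) (rule that)
  define C where "C = transpose S ** B ** S"
  have symC: "transpose C = C"
    using B by (simp add: C_def matrix_transpose_mul matrix_mul_assoc sym_posdef_def)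
  \<comment> \<open>\<open>v \<bullet> (G *v v)\<close> is half the derivative at
    \<open>t = 0\<close> of the objective along \<open>S ** transvection t v\<close>.\<close>
  define G :: "'n sqmat2" where "G = (\<chi> k l. w k * (C ** Jmat) $ k $ l)"
  have "v \<bullet> (G *v v) = 0" for v
  proof -
    define u where "u = Jmat *v v"
    have Gv: "v \<bullet> (G *v v) = (\<Sum>k\<in>UNIV. w k * (v $ k * (C *v u) $ k))"
      by (simp add: inner_vec_def G_def u_def matrix_vector_mul_assoc)
        (simp add: matrix_vector_mult_def sum_distrib_left mult_ac)
    have "0 \<le> 2 * t * (v \<bullet> (G *v v)) + t\<^sup>2 * (\<Sum>k\<in>UNIV. w k * ((v $ k)\<^sup>2 * (u \<bullet> (C *v u))))" for t
    proof -
      have "f (S ** transvection t v) =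
        (\<Sum>k\<in>UNIV. w k * (transpose (transvection t v) ** C ** transvection t v) $ k $ k)"
        by (simp add: f_def C_def congruence_mult)
      also have "\<dots> = (\<Sum>k\<in>UNIV. w k * (C $ k $ k + 2 * t * (v $ k * (C *v u) $ k)
          + t\<^sup>2 * ((v $ k)\<^sup>2 * (u \<bullet> (C *v u)))))"
      proof (rule sum.cong[OF refl], rule arg_cong[of _ _ "(*) (w _)"])
        fix k :: "'n + 'n"
        have a: "axis k 1 \<bullet> x = x $ k" for x :: "real ^ ('n + 'n)" by (simp add: inner_axis')
        have b: "u \<bullet> (C *v axis k 1) = (C *v u) $ k"
          by (simp add: inner_symmetric_matrix[OF symC, of u] a)
        have d: "(C *v axis k 1) $ k = C $ k $ k"
          by (simp add: matrix_vector_mult_basis column_def)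
        show "(transpose (transvection t v) ** C ** transvection t v) $ k $ k =
          C $ k $ k + 2 * t * (v $ k * (C *v u) $ k) + t\<^sup>2 * ((v $ k)\<^sup>2 * (u \<bullet> (C *v u)))"
          unfolding congruence_nth column_transvection u_def[symmetric]
            matrix_vector_right_distrib matrix_vector_mult_scaleR
            inner_add_left inner_add_right inner_scaleR_left inner_scaleR_right a b
          by (simp add: d algebra_simps power2_eq_square)
      qed
      also have "\<dots> = f S + (2 * t * (v \<bullet> (G *v v)) + t\<^sup>2 * (\<Sum>k\<in>UNIV. w k * ((v $ k)\<^sup>2 * (u \<bullet> (C *v u)))))"
        unfolding f_def C_def[symmetric] Gv sum_distrib_left sum.distrib[symmetric]
        by (rule sum.cong) (simp_all add: algebra_simps)
      finally show ?thesis
        using S(2)[OF symplectic_mult[OF S(1) symplectic_transvection[of t v]]]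
        by (simp only: le_add_same_cancel1)
    qed
    then show ?thesis by (rule linear_coeff_zero)
  qed
  then have skew: "G $ p $ q = - G $ q $ p" for p q by (rule quadratic_form_zero_imp_skew)
  have sC: "C $ p $ q = C $ q $ p" for p q
    using arg_cong[OF symC, of "\<lambda>M. M $ p $ q"] by (simp add: transpose_def)
  \<comment> \<open>Skewness of \<open>G\<close> read block by block, using the symmetry of
    \<open>C\<close>.\<close>
  have e1: "h i * C $ Inl i $ Inl j = h j * C $ Inr i $ Inr j" for i j
    using skew[of "Inl i" "Inr j"] sC[of "Inr j"] by (simp add: G_def w_def)
  have e1': "h i * C $ Inr i $ Inr j = h j * C $ Inl i $ Inl j" for i j
    using skew[of "Inr i" "Inl j"] sC[of "Inl j"] by (simp add: G_def w_def)
  have e2: "h i * C $ Inl i $ Inr j = - (h j * C $ Inr i $ Inl j)" for i j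
    using skew[of "Inl i" "Inl j"] sC[of "Inl j"] by (simp add: G_def w_def)
  have e2': "h i * C $ Inr i $ Inl j = - (h j * C $ Inl i $ Inr j)" for i j
    using skew[of "Inr i" "Inr j"] sC[of "Inr j"] by (simp add: G_def w_def)
  have off: "a = 0" if "i \<noteq> j" "h i * a = h j * b" "h i * b = h j * a" for i j a b
  proof -
    have "(h i * h i) * a = h i * (h j * b)" using that by simp
    also have "\<dots> = (h j * h j) * a" using that by simp
    finally have "a = 0 \<or> h i * h i = h j * h j" by simp
    moreover have "h i * h i \<noteq> h j * h j"
      using that(1) h1[of i] h1[of j] g by (auto simp: square_eq_iff h_def inj_eq)
    ultimately show ?thesis by blast
  qed
  define d :: "real ^ 'n" where "d = (\<chi> i. C $ Inl i $ Inl i)"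
  have hn: "h i \<noteq> 0" for i using h1[of i] by linarith
  have "C = blockdiag d d"
  proof -
    have LL: "C $ Inl i $ Inl j = (if i = j then d $ i else 0)" for i j
      using off[OF _ e1 e1', of i j] by (simp add: d_def)
    have RR: "C $ Inr i $ Inr j = (if i = j then d $ i else 0)" for i j
      using off[OF _ e1' e1, of i j] e1[of i i] hn[of i] by (auto simp: d_def)
    have LR: "C $ Inl i $ Inr j = 0" for i j
    proof (cases "i = j")
      case True
      have "h i * C $ Inl i $ Inr i = - (h i * C $ Inl i $ Inr i)"
        using e2[of i i] sC[of "Inr i" "Inl i"] by simp
      then show ?thesis using True hn[of i] by simp
    next
      case False
      then show ?thesis using off[of i j "C $ Inl i $ Inr j" "- C $ Inr i $ Inl j"] e2[of i j] e2'[of i j] by simp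
    qed
    show ?thesis unfolding matrix_eq_sum_index using LL RR LR sC[of "Inr _" "Inl _"] by simp
  qed
  moreover have "d $ i > 0" for i
  proof -
    obtain T where T: "T ** S = mat 1" using symplectic_inverse[OF S(1)] by blast
    \<comment> \<open>Each \<open>d $ i\<close> is the form of \<open>B\<close> at a column of the
      invertible \<open>S\<close>.\<close>
    have "column (Inl i) S \<noteq> 0"
    proof
      assume "column (Inl i) S = 0"
      then have "S *v axis (Inl i) 1 = 0" by (simp add: matrix_vector_mult_basis)
      then have "(T ** S) *v axis (Inl i) 1 = 0"
        by (metis matrix_vector_mul_assoc matrix_vector_mult_0_right)
      then show False by (simp add: T axis_eq_0_iff)
    qed
    then show ?thesis using B by (simp add: d_def C_def congruence_nth sym_posdef_def)
  qed
  ultimately have "williamson_form B S d" by (simp add: williamson_form_def C_def)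
  with S(1) show ?thesis by (rule that)
qed

section \<open>Orthosymplectic diagonalization\<close>

text \<open>Row sums of \<open>P\<close> are squared norms of rows of \<open>S\<close>; commutation
  with \<open>Jmat\<close> turns its column sums into squared norms of columns.\<close>

lemma orthosymplectic_imp_majorized:
  fixes B S :: "('n::finite) sqmat2"
  assumes S: "orthosymplectic S" and w: "williamson_form B S d"
  shows "majorized (Delta11 B) d"
proof -
  have o: "transpose S ** S = mat 1" "S ** transpose S = mat 1"
    using S by (simp_all add: orthosymplectic_def orthogonal_matrix_def)
  have "S ** Jmat = S ** (transpose S ** Jmat ** S)"
    using S by (simp add: orthosymplectic_def symplectic_def)
  also have "\<dots> = Jmat ** S" by (simp add: matrix_mul_assoc o)
  finally have com: "S ** Jmat = Jmat ** S" .
  have LR: "S $ Inl i $ Inr j = - S $ Inr i $ Inl j" for i j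
    using arg_cong[OF com, of "\<lambda>P. P $ Inl i $ Inl j"] by simp
  have "B = (S ** transpose S) ** B ** (S ** transpose S)" by (simp add: o)
  also have "\<dots> = transpose (transpose S) ** (transpose S ** B ** S) ** transpose S"
    by (simp add: matrix_mul_assoc)
  finally have Beq: "B = transpose (transpose S) ** blockdiag d d ** transpose S"
    using w by (simp add: williamson_form_def)
  define P where "P i j = (S $ Inl i $ Inl j)\<^sup>2 + (S $ Inl i $ Inr j)\<^sup>2" for i j
  show ?thesis
  proof (rule majorized_doubly_stochastic[of _ P])
    fix i
    show "Delta11 B $ i = (\<Sum>j\<in>UNIV. P i j * d $ j)"
      unfolding Delta11_def vec_lambda_beta
      by (subst Beq, subst congruence_blockdiag_diag) (simp add: transpose_def P_def mult.commute)
    have "(S ** transpose S) $ Inl i $ Inl i = 1" by (simp add: o mat_def)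
    then show "(\<Sum>j\<in>UNIV. P i j) = 1"
      by (simp add: matrix_matrix_mult_def transpose_def sum_UNIV_Plus P_def sum.distrib power2_eq_square)
  next
    fix j
    have "(transpose S ** S) $ Inl j $ Inl j = 1" by (simp add: o mat_def)
    then show "(\<Sum>i\<in>UNIV. P i j) = 1"
      by (simp add: matrix_matrix_mult_def transpose_def sum_UNIV_Plus P_def LR sum.distrib power2_eq_square)
  qed (simp add: P_def)
qed

text \<open>Row \<open>Inl j\<close> of a symplectic \<open>T\<close> pairs to 1 with \<open>Jmat\<close> applied to row \<open>Inr j\<close>, so
  the trace of \<open>transpose T ** blockdiag d d ** T\<close> is at least twice the sum of \<open>d\<close>, with equality
  only when \<open>T\<close> commutes with \<open>Jmat\<close>.\<close>

lemma trace_minimal_imp_orthosymplectic: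
  fixes T :: "('n::finite) sqmat2"
  assumes T: "symplectic T" and d: "\<And>i. d $ i > 0"
    and tr: "trace (transpose T ** blockdiag d d ** T) = 2 * (\<Sum>i\<in>UNIV. d $ i)"
  shows "orthosymplectic T"
proof -
  have TJ: "T ** Jmat ** transpose T = Jmat" using symplectic_inverse[OF T] by blast
  \<comment> \<open>These squares vanish for all indices exactly when \<open>T\<close> commutes with
    \<open>Jmat\<close>.\<close>
  define e where "e j i = (T $ Inl j $ Inl i - T $ Inr j $ Inr i)\<^sup>2
      + (T $ Inl j $ Inr i + T $ Inr j $ Inl i)\<^sup>2" for j i
  define N where "N j = (\<Sum>p\<in>UNIV. (T $ Inl j $ p)\<^sup>2 + (T $ Inr j $ p)\<^sup>2)" for j
  \<comment> \<open>The cross terms of the squares add up to -2 times the pairing of rows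
    \<open>Inl j\<close> and \<open>Inr j\<close>, which is 1.\<close>
  have eN: "(\<Sum>i\<in>UNIV. e j i) = N j - 2" for j
  proof -
    have "(T ** Jmat ** transpose T) $ Inl j $ Inr j = 1" by (simp add: TJ)
    then have "(\<Sum>i\<in>UNIV. T $ Inl j $ Inl i * T $ Inr j $ Inr i) -
         (\<Sum>i\<in>UNIV. T $ Inl j $ Inr i * T $ Inr j $ Inl i) = 1"
      by (subst (asm) matrix_matrix_mult_def) (simp add: transpose_def sum_UNIV_Plus sum_negf)
    then show ?thesis
      by (simp add: e_def N_def sum_UNIV_Plus power2_sum power2_diff sum.distrib sum_subtractf
          sum_distrib_left[symmetric] mult.assoc)
  qed
  have "trace (transpose T ** blockdiag d d ** T) = (\<Sum>j\<in>UNIV. d $ j * N j)"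
    unfolding trace_def congruence_blockdiag_diag N_def sum_distrib_left by (rule sum.swap)
  with tr have "(\<Sum>j\<in>UNIV. d $ j * (\<Sum>i\<in>UNIV. e j i)) = 0"
    by (simp add: eN right_diff_distrib sum_subtractf sum_distrib_right[symmetric])
  moreover have e0: "e j i \<ge> 0" for j i by (simp add: e_def)
  ultimately have "d $ j * (\<Sum>i\<in>UNIV. e j i) = 0" for j
    using d by (subst (asm) sum_nonneg_eq_0_iff) (auto simp: sum_nonneg less_imp_le)
  then have "(\<Sum>i\<in>UNIV. e j i) = 0" for j using d[of j] by (metis less_irrefl mult_eq_0_iff)
  then have "e j i = 0" for j i using e0 by (simp add: sum_nonneg_eq_0_iff)
  then have "T $ Inl j $ Inl i = T $ Inr j $ Inr i" "T $ Inl j $ Inr i = - T $ Inr j $ Inl i" for j i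
    unfolding e_def sum_power2_eq_zero_iff by (simp_all add: eq_neg_iff_add_eq_0)
  then have com: "T ** Jmat = Jmat ** T" by (simp add: matrix_eq_sum_index)
  \<comment> \<open>Moving one \<open>Jmat\<close> across \<open>T\<close> exposes the symplectic
    relation.\<close>
  have "transpose T ** T = - (transpose T ** T ** (Jmat ** Jmat))"
    by (simp add: Jmat_square matrix_mul_minus)
  also have "\<dots> = - (transpose T ** (T ** Jmat) ** Jmat)" by (simp add: matrix_mul_assoc)
  also have "\<dots> = - (transpose T ** Jmat ** T ** Jmat)" by (simp add: com matrix_mul_assoc)
  also have "\<dots> = mat 1" using T by (simp add: symplectic_def Jmat_square)
  finally show ?thesis using T by (simp add: orthosymplectic_def orthogonal_matrix)
qed

text \<open>The inverse \<open>T\<close> of \<open>S\<close> carries the diagonal form back to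
  \<open>B\<close>, so the hypothesis says that \<open>T\<close> attains the trace bound; then
  \<open>S\<close> is \<open>transpose T\<close>.\<close>

lemma sum_eq_trace_imp_orthosymp_diagonalizable:
  fixes B S :: "('n::finite) sqmat2"
  assumes S: "symplectic S" and w: "williamson_form B S d"
    and tr: "trace B = 2 * (\<Sum>i\<in>UNIV. d $ i)"
  shows "orthosymp_diagonalizable B"
proof -
  obtain T where T: "symplectic T" "T ** S = mat 1" "S ** T = mat 1"
    using symplectic_inverse[OF S] by blast
  have "B = transpose (S ** T) ** B ** (S ** T)" by (simp add: T)
  also have "\<dots> = transpose T ** (transpose S ** B ** S) ** T" by (rule congruence_mult)
  finally have Beq: "transpose T ** blockdiag d d ** T = B"
    using w by (simp add: williamson_form_def)
  have "orthosymplectic T"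
    using w tr by (intro trace_minimal_imp_orthosymplectic[OF T(1)]) (auto simp: Beq williamson_form_def)
  then have o: "T ** transpose T = mat 1" by (simp add: orthosymplectic_def orthogonal_matrix_def)
  have "S = S ** (T ** transpose T)" by (simp add: o)
  also have "\<dots> = transpose T" by (simp add: matrix_mul_assoc T)
  finally have "orthogonal_matrix S"
    using \<open>orthosymplectic T\<close> by (simp add: orthosymplectic_def)
  then show ?thesis using S w by (auto simp: orthosymp_diagonalizable_def orthosymplectic_def)
qed

text \<open>Williamson's theorem gives the choice in \<open>sympl_eigs\<close> a witness.\<close>

lemma sympl_eigs_williamson:
  assumes "sym_posdef A"
  obtains S where "symplectic S" "williamson_form A S (sympl_eigs A)"
proof -
  have "\<exists>d S. symplectic S \<and> williamson_form A S d" using williamson[OF assms] by metis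
  then have "\<exists>S. symplectic S \<and> williamson_form A S (sympl_eigs A)"
    unfolding sympl_eigs_def by (rule someI_ex)
  then show ?thesis using that by blast
qed

section \<open>Balancing the diagonal by fourth roots, and the equivalence\<close>

lemma diag_pos:
  assumes "sym_posdef A"
  shows "A $ i $ i > 0"
proof -
  have "axis i 1 \<bullet> (A *v axis i 1) > 0" using assms by (simp add: sym_posdef_def axis_eq_0_iff)
  then show ?thesis by (simp add: inner_axis' matrix_vector_mult_basis column_def)
qed

lemma root4_square:
  assumes "x \<ge> 0"
  shows "root 4 x * root 4 x = sqrt x"
proof -
  have "root 4 x = sqrt (sqrt x)"
    using real_root_mult_exp[of 2 2 x] by (simp add: sqrt_def)
  then show ?thesis using assms by simp
qed

text \<open>Scaling on both sides contributes the square root of y/x, which moves \<open>x\<close>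
  to the geometric mean of \<open>x\<close> and \<open>y\<close>.\<close>

lemma root4_balance:
  fixes x y :: real
  assumes "x > 0" "y > 0"
  shows "root 4 (inverse x * y) * x * root 4 (inverse x * y) = sqrt (x * y)"
proof -
  have "root 4 (inverse x * y) * x * root 4 (inverse x * y) = sqrt (x\<^sup>2) * sqrt (inverse x * y)"
    using assms root4_square[of "inverse x * y"] by (simp add: mult_ac)
  also have "\<dots> = sqrt (x * y)"
    unfolding real_sqrt_mult[symmetric] using assms by (simp add: power2_eq_square field_simps)
  finally show ?thesis .
qed

theorem theorem1p1:
  fixes A :: "real ^ ('n::finite + 'n) ^ ('n + 'n)"
  assumes "sym_posdef A"
  shows "symplectic (Mmat A) \<and>
    (majorized (Delta_s A) (sympl_eigs A) \<longleftrightarrow> orthosymp_diagonalizable (Mmat A ** A ** Mmat A))"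
proof
  have pos: "Delta11 A $ i > 0" "Delta22 A $ i > 0" for i
    using diag_pos[OF assms] by (simp_all add: Delta11_def Delta22_def)
  \<comment> \<open>Paired diagonal entries are fourth roots of reciprocal numbers.\<close>
  show M: "symplectic (Mmat A)"
    unfolding Mmat_def using pos[THEN less_imp_neq]
    by (intro symplectic_blockdiag) (simp add: real_root_mult[symmetric] field_simps)
  define B where "B = Mmat A ** A ** Mmat A"
  have Mt: "transpose (Mmat A) = Mmat A" by (simp add: Mmat_def)
  have B1: "Delta11 B = Delta_s A"
    using root4_balance[OF pos(1) pos(2)]
    by (simp add: vec_eq_iff B_def Mmat_def blockdiag_mult_nth Delta_s_def Delta11_def)
  have B2: "Delta22 B = Delta_s A"
    using root4_balance[OF pos(2) pos(1)]
    by (simp add: vec_eq_iff B_def Mmat_def blockdiag_mult_nth Delta_s_def Delta22_def mult.commute)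
  obtain S where S: "symplectic S" "williamson_form A S (sympl_eigs A)"
    using sympl_eigs_williamson[OF assms] .
  \<comment> \<open>With \<open>L\<close> inverse to \<open>Mmat A\<close>, the matrix
    \<open>L ** S\<close> brings \<open>B\<close> to the same form as \<open>S\<close> brings
    \<open>A\<close>.\<close>
  obtain L where L: "symplectic L" "Mmat A ** L = mat 1"
    using symplectic_inverse[OF M] by blast
  have "transpose (L ** S) ** B ** (L ** S)
      = transpose S ** (transpose (Mmat A ** L) ** A ** (Mmat A ** L)) ** S"
    by (simp add: B_def matrix_transpose_mul matrix_mul_assoc Mt)
  then have wB: "williamson_form B (L ** S) (sympl_eigs A)"
    using S(2) by (simp add: L williamson_form_def)
  have sB: "symplectic (L ** S)" using L S by (simp add: symplectic_mult)
  show "majorized (Delta_s A) (sympl_eigs A) \<longleftrightarrow> orthosymp_diagonalizable (Mmat A ** A ** Mmat A)"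
    unfolding B_def[symmetric]
  proof
    assume "majorized (Delta_s A) (sympl_eigs A)"
    then have "(\<Sum>i\<in>UNIV. Delta_s A $ i) = (\<Sum>i\<in>UNIV. sympl_eigs A $ i)"
      by (simp add: majorized_def sum_list_sorted_entries)
    moreover have "trace B = (\<Sum>i\<in>UNIV. Delta11 B $ i) + (\<Sum>i\<in>UNIV. Delta22 B $ i)"
      by (simp add: trace_def sum_UNIV_Plus Delta11_def Delta22_def)
    ultimately show "orthosymp_diagonalizable B"
      by (intro sum_eq_trace_imp_orthosymp_diagonalizable[OF sB wB]) (simp add: B1 B2)
  next
    assume "orthosymp_diagonalizable B"
    then obtain Q d where Q: "orthosymplectic Q" "williamson_form B Q d"
      by (auto simp: orthosymp_diagonalizable_def)
    \<comment> \<open>\<open>d\<close> may list the eigenvalues in another order than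
      \<open>sympl_eigs A\<close>; majorization sees only sorted entries.\<close>
    have "sorted_entries d = sorted_entries (sympl_eigs A)"
      using symplectic_eigenvalues_unique[OF _ sB Q(2) wB] Q(1) by (simp add: orthosymplectic_def)
    then show "majorized (Delta_s A) (sympl_eigs A)"
      using orthosymplectic_imp_majorized[OF Q] by (simp add: majorized_def B1)
  qed
qed

end
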